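(* Let $q\geq5$ be an integer, let $n=5q$, and let $H_q$ be the graph with vertex set $\{a_i,b_i:i\in\mathbb Z_n\}$ and adjacencies $a_i\sim a_{i\pm1},a_{i\pm q},b_i$ and $b_i\sim b_{i\pm1},b_{i\pm2q},a_i$ for all $i\in\mathbb Z_n$ (subscripts modulo $n$). Then, for every $i\in\mathbb Z_n$, $$\kappa_0(a_i,a_{i+1})=\kappa_0(b_i,b_{i+1})=0,\qquad \kappa_0(a_i,a_{i+q})=\kappa_0(b_i,b_{i+2q})=\kappa_0(a_i,b_i)=-\tfrac15 .$$ Hence $H_q$ is not bone-idle.
   Context: $H_q$ is a simple connected $5$-regular graph on $2n=10q$ distinct vertices. For a connected graph with shortest-path distance $d$, vertex $x$ of degree $d_x$ with neighborhood $N(x)$, and $\alpha\in[0,1]$, let $\mu_x^\alpha$ be the probability measure with $\mu_x^\alpha(x)=\alpha$, $\mu_x^\alpha(z)=(1-\alpha)/d_x$ for $z\in N(x)$, and $0$ otherwise. For probability measures $\mu,\nu$ on $V$, $W_1(\mu,\nu)=\min_\pi\sum_{u,v\in V}d(u,v)\pi(u,v)$, the minimum being over all $\pi:V\times V\to[0,1]$ with marginals $\mu$ and $\nu$. For an edge $xy$, the Ollivier--Ricci curvature with idleness $\alpha$ is $\kappa_\alpha(x,y)=1-W_1(\mu_x^\alpha,\mu_y^\alpha)$; $\kappa_0$ is the case $\alpha=0$. An edge $xy$ is bone-idle if $\kappa_\alpha(x,y)=0$ for every $\alpha\in[0,1]$; a graph is bone-idle if each of its edges is bone-idle. *)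

theory Defs
  imports Complex_Main
begin

text \<open>
  A finite simple graph is given by its vertex set \<open>V\<close> and its adjacency relation \<open>E\<close>, a
  symmetric and irreflexive relation on \<open>V\<close>; thus each undirected edge occurs in both orientations.
\<close>

text \<open>Shortest-path distance; the value is meaningful only for vertices joined by a walk.\<close>

definition graph_dist :: "('a \<times> 'a) set \<Rightarrow> 'a \<Rightarrow> 'a \<Rightarrow> nat" where
  "graph_dist E u v = (LEAST k. (u, v) \<in> E ^^ k)"

definition degree :: "('a \<times> 'a) set \<Rightarrow> 'a \<Rightarrow> nat" where
  "degree E x = card (E `` {x})"

definition lazy_measure :: "('a \<times> 'a) set \<Rightarrow> real \<Rightarrow> 'a \<Rightarrow> 'a \<Rightarrow> real" where
  "lazy_measure E \<alpha> x z =
     (if z = x then \<alpha> else if z \<in> E `` {x} then (1 - \<alpha>) / real (degree E x) else 0)"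

definition coupling ::
  "'a set \<Rightarrow> ('a \<Rightarrow> real) \<Rightarrow> ('a \<Rightarrow> real) \<Rightarrow> ('a \<Rightarrow> 'a \<Rightarrow> real) \<Rightarrow> bool" where
  "coupling V \<mu> \<nu> \<pi> \<longleftrightarrow>
     (\<forall>u\<in>V. \<forall>v\<in>V. 0 \<le> \<pi> u v \<and> \<pi> u v \<le> 1) \<and>
     (\<forall>u\<in>V. (\<Sum>v\<in>V. \<pi> u v) = \<mu> u) \<and>
     (\<forall>v\<in>V. (\<Sum>u\<in>V. \<pi> u v) = \<nu> v)"

definition transport_cost ::
  "'a set \<Rightarrow> ('a \<times> 'a) set \<Rightarrow> ('a \<Rightarrow> 'a \<Rightarrow> real) \<Rightarrow> real" where
  "transport_cost V E \<pi> = (\<Sum>u\<in>V. \<Sum>v\<in>V. real (graph_dist E u v) * \<pi> u v)"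

text \<open>
  On the reals, \<open>LEAST\<close> denotes the minimum of a set of values provided that it is attained,
  which is the case for the costs of the couplings of two probability measures on a finite set.
\<close>

definition W1 ::
  "'a set \<Rightarrow> ('a \<times> 'a) set \<Rightarrow> ('a \<Rightarrow> real) \<Rightarrow> ('a \<Rightarrow> real) \<Rightarrow> real" where
  "W1 V E \<mu> \<nu> = (LEAST w. \<exists>\<pi>. coupling V \<mu> \<nu> \<pi> \<and> w = transport_cost V E \<pi>)"

definition curvature :: "'a set \<Rightarrow> ('a \<times> 'a) set \<Rightarrow> real \<Rightarrow> 'a \<Rightarrow> 'a \<Rightarrow> real" where
  "curvature V E \<alpha> x y = 1 - W1 V E (lazy_measure E \<alpha> x) (lazy_measure E \<alpha> y)"

definition bone_idle_edge :: "'a set \<Rightarrow> ('a \<times> 'a) set \<Rightarrow> 'a \<Rightarrow> 'a \<Rightarrow> bool" where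
  "bone_idle_edge V E x y \<longleftrightarrow> (\<forall>\<alpha>\<in>{0..1}. curvature V E \<alpha> x y = 0)"

definition bone_idle :: "'a set \<Rightarrow> ('a \<times> 'a) set \<Rightarrow> bool" where
  "bone_idle V E \<longleftrightarrow> (\<forall>(x, y)\<in>E. bone_idle_edge V E x y)"

text \<open>
  Elements of \<open>\<int>/n\<int>\<close> with \<open>n = 5q\<close> are represented by their residues in \<open>{0..<n}\<close>; the vertices
  \<open>va q i\<close> and \<open>vb q i\<close> reduce an arbitrary integer subscript modulo \<open>5q\<close>.
\<close>

datatype vertex = A int | B int

definition va :: "int \<Rightarrow> int \<Rightarrow> vertex" where
  "va q i = A (i mod (5 * q))"

definition vb :: "int \<Rightarrow> int \<Rightarrow> vertex" where
  "vb q i = B (i mod (5 * q))"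

definition H_verts :: "int \<Rightarrow> vertex set" where
  "H_verts q = range (va q) \<union> range (vb q)"

definition H_adj :: "int \<Rightarrow> (vertex \<times> vertex) set" where
  "H_adj q =
     (\<Union>i. {(va q i, va q (i + 1)), (va q i, va q (i - 1)),
           (va q i, va q (i + q)), (va q i, va q (i - q)), (va q i, vb q i),
           (vb q i, vb q (i + 1)), (vb q i, vb q (i - 1)),
           (vb q i, vb q (i + 2 * q)), (vb q i, vb q (i - 2 * q)), (vb q i, va q i)})"

text \<open>The pair \<open>(H_verts q, H_adj q)\<close> is a simple connected 5-regular graph on \<open>10q\<close> vertices.\<close>

lemma mod_shift_neq:
  fixes n i c d :: int
  assumes "c \<noteq> d" "\<bar>c - d\<bar> < n"
  shows "(i + c) mod n \<noteq> (i + d) mod n"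
proof
  assume "(i + c) mod n = (i + d) mod n"
  then have "n dvd c - d"
    by (metis add_diff_cancel_left mod_eq_dvd_iff)
  then show False
    using assms dvd_imp_le_int[of "c - d" n] by auto
qed

lemma H_adj_subset: "H_adj q \<subseteq> H_verts q \<times> H_verts q"
  by (auto simp: H_adj_def H_verts_def)

lemma H_adj_intros:
  "(va q i, va q (i + 1)) \<in> H_adj q" "(va q i, va q (i - 1)) \<in> H_adj q"
  "(va q i, va q (i + q)) \<in> H_adj q" "(va q i, va q (i - q)) \<in> H_adj q"
  "(va q i, vb q i) \<in> H_adj q"
  "(vb q i, vb q (i + 1)) \<in> H_adj q" "(vb q i, vb q (i - 1)) \<in> H_adj q"
  "(vb q i, vb q (i + 2 * q)) \<in> H_adj q" "(vb q i, vb q (i - 2 * q)) \<in> H_adj q"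
  "(vb q i, va q i) \<in> H_adj q"
  unfolding H_adj_def by blast+

lemma H_adj_cases:
  assumes "(x, y) \<in> H_adj q"
  obtains i where "x = va q i"
      "y \<in> {va q (i + 1), va q (i - 1), va q (i + q), va q (i - q), vb q i}"
    | i where "x = vb q i"
      "y \<in> {vb q (i + 1), vb q (i - 1), vb q (i + 2 * q), vb q (i - 2 * q), va q i}"
  using assms unfolding H_adj_def by blast

lemma H_adj_sym: "sym (H_adj q)"
proof (rule symI)
  fix x y assume "(x, y) \<in> H_adj q"
  then show "(y, x) \<in> H_adj q"
  proof (cases rule: H_adj_cases)
    case (1 i)
    then show ?thesis
      using H_adj_intros(2)[of q "i + 1"] H_adj_intros(1)[of q "i - 1"]
        H_adj_intros(4)[of q "i + q"] H_adj_intros(3)[of q "i - q"] H_adj_intros(10)[of q i]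
      by auto
  next
    case (2 i)
    then show ?thesis
      using H_adj_intros(7)[of q "i + 1"] H_adj_intros(6)[of q "i - 1"]
        H_adj_intros(9)[of q "i + 2 * q"] H_adj_intros(8)[of q "i - 2 * q"] H_adj_intros(5)[of q i]
      by auto
  qed
qed

lemma vertex_eqs:
  "va q i = va q j \<longleftrightarrow> i mod (5 * q) = j mod (5 * q)"
  "vb q i = vb q j \<longleftrightarrow> i mod (5 * q) = j mod (5 * q)"
  "va q i \<noteq> vb q j" "vb q i \<noteq> va q j"
  by (simp_all add: va_def vb_def)

lemma H_neighbours_a:
  "H_adj q `` {va q i} = {va q (i + 1), va q (i - 1), va q (i + q), va q (i - q), vb q i}"
    (is "_ = ?N i")
proof
  show "H_adj q `` {va q i} \<subseteq> ?N i"
  proof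
    fix y assume "y \<in> H_adj q `` {va q i}"
    then have "(va q i, y) \<in> H_adj q" by blast
    then obtain j where j: "va q i = va q j" and y: "y \<in> ?N j"
      by (cases rule: H_adj_cases) (auto simp only: vertex_eqs)
    have m: "j mod (5 * q) = i mod (5 * q)"
      using j by (simp add: vertex_eqs)
    have "?N j = ?N i"
      using mod_add_cong[OF m refl] mod_diff_cong[OF m refl] m
      by (simp only: va_def vb_def)
    with y show "y \<in> ?N i" by simp
  qed
qed (use H_adj_intros in blast)

lemma H_neighbours_b:
  "H_adj q `` {vb q i} = {vb q (i + 1), vb q (i - 1), vb q (i + 2 * q), vb q (i - 2 * q), va q i}"
    (is "_ = ?N i")
proof
  show "H_adj q `` {vb q i} \<subseteq> ?N i"
  proof
    fix y assume "y \<in> H_adj q `` {vb q i}"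
    then have "(vb q i, y) \<in> H_adj q" by blast
    then obtain j where j: "vb q i = vb q j" and y: "y \<in> ?N j"
      by (cases rule: H_adj_cases) (auto simp only: vertex_eqs)
    have m: "j mod (5 * q) = i mod (5 * q)"
      using j by (simp add: vertex_eqs)
    have "?N j = ?N i"
      using mod_add_cong[OF m refl] mod_diff_cong[OF m refl] m
      by (simp only: va_def vb_def)
    with y show "y \<in> ?N i" by simp
  qed
qed (use H_adj_intros in blast)

lemma H_adj_irrefl:
  assumes "q \<ge> 5"
  shows "(x, x) \<notin> H_adj q"
proof
  assume *: "(x, x) \<in> H_adj q"
  then consider i where "x = va q i" | i where "x = vb q i"
    using H_adj_subset unfolding H_verts_def by blast
  then show False
  proof cases
    case (1 i)
    with * have "va q i \<in> H_adj q `` {va q i}" by blast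
    then show False
      using assms mod_shift_neq[of 0 1 "5 * q" i] mod_shift_neq[of 0 "-1" "5 * q" i]
        mod_shift_neq[of 0 q "5 * q" i] mod_shift_neq[of 0 "-q" "5 * q" i]
      unfolding H_neighbours_a by (auto simp: va_def vb_def)
  next
    case (2 i)
    with * have "vb q i \<in> H_adj q `` {vb q i}" by blast
    then show False
      using assms mod_shift_neq[of 0 1 "5 * q" i] mod_shift_neq[of 0 "-1" "5 * q" i]
        mod_shift_neq[of 0 "2 * q" "5 * q" i] mod_shift_neq[of 0 "-(2 * q)" "5 * q" i]
      unfolding H_neighbours_b by (auto simp: va_def vb_def)
  qed
qed

lemma H_regular:
  assumes "q \<ge> 5" "x \<in> H_verts q"
  shows "degree (H_adj q) x = 5"
proof -
  from assms(2) consider i where "x = va q i" | i where "x = vb q i"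
    unfolding H_verts_def by blast
  then show ?thesis
  proof cases
    case (1 i)
    show ?thesis
      using assms(1) mod_shift_neq[of 1 "-1" "5 * q" i] mod_shift_neq[of 1 q "5 * q" i]
        mod_shift_neq[of 1 "-q" "5 * q" i] mod_shift_neq[of "-1" q "5 * q" i]
        mod_shift_neq[of "-1" "-q" "5 * q" i] mod_shift_neq[of q "-q" "5 * q" i]
      unfolding 1 degree_def H_neighbours_a by (simp add: va_def vb_def)
  next
    case (2 i)
    show ?thesis
      using assms(1) mod_shift_neq[of 1 "-1" "5 * q" i] mod_shift_neq[of 1 "2 * q" "5 * q" i]
        mod_shift_neq[of 1 "-(2 * q)" "5 * q" i] mod_shift_neq[of "-1" "2 * q" "5 * q" i]
        mod_shift_neq[of "-1" "-(2 * q)" "5 * q" i]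
        mod_shift_neq[of "2 * q" "-(2 * q)" "5 * q" i]
      unfolding 2 degree_def H_neighbours_b by (simp add: va_def vb_def)
  qed
qed

lemma H_verts_eq:
  assumes "q \<ge> 5"
  shows "H_verts q = A ` {0..<5 * q} \<union> B ` {0..<5 * q}"
proof -
  have r: "range (\<lambda>i. i mod (5 * q)) = {0..<5 * q}"
  proof
    show "{0..<5 * q} \<subseteq> range (\<lambda>i. i mod (5 * q))"
      by (metis atLeastLessThan_iff mod_pos_pos_trivial rangeI subsetI)
  qed (use assms in auto)
  have "range (va q) = A ` {0..<5 * q}" "range (vb q) = B ` {0..<5 * q}"
    unfolding r[symmetric] by (auto simp: va_def vb_def)
  then show ?thesis by (simp add: H_verts_def)
qed

lemma H_finite: "q \<ge> 5 \<Longrightarrow> finite (H_verts q)"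
  by (simp add: H_verts_eq)

lemma H_card:
  assumes "q \<ge> 5"
  shows "int (card (H_verts q)) = 10 * q"
proof -
  have "card (H_verts q) = card (A ` {0..<5 * q}) + card (B ` {0..<5 * q})"
    unfolding H_verts_eq[OF assms] by (rule card_Un_disjoint) auto
  then show ?thesis
    using assms by (simp add: card_image inj_on_def)
qed

lemma H_connected:
  assumes "x \<in> H_verts q" "y \<in> H_verts q"
  shows "(x, y) \<in> (H_adj q)\<^sup>*"
proof -
  have from0: "(va q 0, va q i) \<in> (H_adj q)\<^sup>*" for i
  proof (induction i rule: int_induct[where k = 0])
    case (step1 i)
    moreover have "(va q i, va q (i + 1)) \<in> H_adj q"
      by (rule H_adj_intros)
    ultimately show ?case by (meson rtrancl.rtrancl_into_rtrancl)
  next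
    case (step2 i)
    moreover have "(va q i, va q (i - 1)) \<in> H_adj q"
      by (rule H_adj_intros)
    ultimately show ?case by (meson rtrancl.rtrancl_into_rtrancl)
  qed simp
  have all: "(va q 0, z) \<in> (H_adj q)\<^sup>*" if "z \<in> H_verts q" for z
  proof -
    have "(va q 0, vb q i) \<in> (H_adj q)\<^sup>*" for i
      using from0[of i] H_adj_intros(5)[of q i] by (meson rtrancl.rtrancl_into_rtrancl)
    then show ?thesis
      using that from0 unfolding H_verts_def by blast
  qed
  have "(x, va q 0) \<in> (H_adj q)\<^sup>*"
    using all[OF assms(1)] sym_rtrancl[OF H_adj_sym] by (meson symD)
  then show ?thesis
    using all[OF assms(2)] by (rule rtrancl_trans)
qed

end

theory Submission
  imports Defs
begin

text \<open>
  The vertices whose index lies in a fixed class modulo \<open>q\<close> induce a Petersen graph, and the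
  edges changing the index by \<open>1\<close> arrange these copies in a cycle. Every Wasserstein distance
  is certified by a perfect matching between the two neighbourhoods (a coupling) together with
  a 1-Lipschitz function that is \<open>1\<close> on a set \<open>P\<close>, \<open>-1\<close> on a set \<open>M\<close> and \<open>0\<close> elsewhere, where
  \<open>P\<close> and \<open>M\<close> are disjoint and joined by no edge. On the edges \<open>a\<^sub>ia\<^sub>i\<^sub>+\<^sub>1\<close> and \<open>b\<^sub>ib\<^sub>i\<^sub>+\<^sub>1\<close> the
  neighbourhoods are disjoint and matched by edges, so the distance is \<open>1\<close>; on the edges of a
  Petersen graph, which has girth five, one pair of the matching has to be at distance \<open>2\<close>.
\<close>

section \<open>Wasserstein distance between neighbourhoods\<close>

lemma graph_dist_le: "(u, v) \<in> E ^^ k \<Longrightarrow> graph_dist E u v \<le> k"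
  unfolding graph_dist_def by (rule Least_le)

lemma lipschitz_relpow:
  fixes f :: "'a \<Rightarrow> real"
  assumes "\<And>u v. (u, v) \<in> E \<Longrightarrow> f v - f u \<le> 1" and "(u, v) \<in> E ^^ k"
  shows "f v - f u \<le> real k"
  using assms(2)
proof (induction k arbitrary: v)
  case (Suc k)
  then obtain w where "(u, w) \<in> E ^^ k" "(w, v) \<in> E" by auto
  with Suc.IH[of w] assms(1)[of w v] show ?case by simp
qed simp

text \<open>Reachability makes the \<open>LEAST\<close> in \<open>graph_dist\<close> attained, so
  the edge bound can be summed along a shortest walk.\<close>

lemma lipschitz_graph_dist:
  fixes f :: "'a \<Rightarrow> real"
  assumes "\<And>u v. (u, v) \<in> E \<Longrightarrow> f v - f u \<le> 1" and "(u, v) \<in> E\<^sup>*"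
  shows "f v - f u \<le> real (graph_dist E u v)"
proof -
  obtain k where "(u, v) \<in> E ^^ k"
    using assms(2) rtrancl_imp_relpow by blast
  then have "(u, v) \<in> E ^^ graph_dist E u v"
    unfolding graph_dist_def by (rule LeastI)
  with assms(1) show ?thesis by (rule lipschitz_relpow)
qed

text \<open>Expanding \<mu> and \<nu> as marginals of \<pi> writes the left side as the
  \<pi>-weighted sum of \<open>f v - f u\<close>.\<close>

lemma transport_cost_ge:
  fixes f :: "'a \<Rightarrow> real"
  assumes \<pi>: "coupling V \<mu> \<nu> \<pi>"
    and f: "\<And>u v. u \<in> V \<Longrightarrow> v \<in> V \<Longrightarrow> f v - f u \<le> real (graph_dist E u v)"
  shows "(\<Sum>v\<in>V. f v * \<nu> v) - (\<Sum>u\<in>V. f u * \<mu> u) \<le> transport_cost V E \<pi>"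
proof -
  have "(\<Sum>v\<in>V. f v * \<nu> v) = (\<Sum>v\<in>V. \<Sum>u\<in>V. f v * \<pi> u v)"
    using \<pi> by (simp add: coupling_def flip: sum_distrib_left)
  also have "\<dots> = (\<Sum>u\<in>V. \<Sum>v\<in>V. f v * \<pi> u v)"
    by (rule sum.swap)
  finally have \<nu>: "(\<Sum>v\<in>V. f v * \<nu> v) = (\<Sum>u\<in>V. \<Sum>v\<in>V. f v * \<pi> u v)" .
  have \<mu>: "(\<Sum>u\<in>V. f u * \<mu> u) = (\<Sum>u\<in>V. \<Sum>v\<in>V. f u * \<pi> u v)"
    using \<pi> by (simp add: coupling_def flip: sum_distrib_left)
  have "(\<Sum>v\<in>V. f v * \<nu> v) - (\<Sum>u\<in>V. f u * \<mu> u)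
      = (\<Sum>u\<in>V. \<Sum>v\<in>V. (f v - f u) * \<pi> u v)"
    unfolding \<mu> \<nu> by (simp add: left_diff_distrib sum_subtractf)
  also have "\<dots> \<le> transport_cost V E \<pi>"
    unfolding transport_cost_def
    using \<pi> f by (intro sum_mono mult_right_mono) (auto simp: coupling_def)
  finally show ?thesis .
qed

text \<open>The primal and dual bounds meet at \<open>w\<close>, which also shows that the
  \<open>LEAST\<close> in \<open>W1\<close> is attained.\<close>

lemma W1_eqI:
  fixes f :: "'a \<Rightarrow> real"
  assumes \<pi>: "coupling V \<mu> \<nu> \<pi>" "transport_cost V E \<pi> \<le> w"
    and f: "\<And>u v. u \<in> V \<Longrightarrow> v \<in> V \<Longrightarrow> f v - f u \<le> real (graph_dist E u v)"
    and w: "w \<le> (\<Sum>v\<in>V. f v * \<nu> v) - (\<Sum>u\<in>V. f u * \<mu> u)"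
  shows "W1 V E \<mu> \<nu> = w"
proof -
  have lower: "w \<le> transport_cost V E \<rho>" if "coupling V \<mu> \<nu> \<rho>" for \<rho>
    using transport_cost_ge[OF that f] w by simp
  with \<pi> have "transport_cost V E \<pi> = w" by (meson order_antisym)
  with \<pi>(1) lower show ?thesis
    unfolding W1_def by (intro Least_equality) auto
qed

section \<open>Transport along a perfect matching\<close>

lemma sum_indicator_nth:
  assumes "distinct xs"
  shows "(\<Sum>k<length xs. of_bool (u = xs ! k)) = (of_bool (u \<in> set xs) :: real)"
proof -
  have "(\<Sum>k<length xs. of_bool (u = xs ! k)) = (\<Sum>x\<leftarrow>xs. of_bool (u = x) :: real)"
    by (simp add: sum_list_sum_nth atLeast0LessThan)
  also have "\<dots> = (\<Sum>x\<in>set xs. of_bool (u = x))"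
    using assms by (rule sum_list_distinct_conv_sum_set)
  also have "\<dots> = of_bool (u \<in> set xs)"
    by (simp add: of_bool_def)
  finally show ?thesis .
qed

definition matching_plan :: "'a list \<Rightarrow> 'a list \<Rightarrow> 'a \<Rightarrow> 'a \<Rightarrow> real" where
  "matching_plan xs ys u v =
     (\<Sum>k<length xs. of_bool (u = xs ! k) * of_bool (v = ys ! k) / real (length xs))"

text \<open>Distinctness puts every listed vertex at exactly one position, so it carries exactly one
  share of the mass.\<close>

lemma coupling_matching_plan:
  assumes "finite V" "set xs \<subseteq> V" "set ys \<subseteq> V" "distinct xs" "distinct ys"
    and len: "length xs = length ys" "xs \<noteq> []"
  shows "coupling V (\<lambda>u. of_bool (u \<in> set xs) / real (length xs))
           (\<lambda>v. of_bool (v \<in> set ys) / real (length xs)) (matching_plan xs ys)"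
  unfolding coupling_def
proof (intro conjI ballI)
  fix u v
  show "0 \<le> matching_plan xs ys u v"
    unfolding matching_plan_def by (intro sum_nonneg) simp
  have "matching_plan xs ys u v \<le> (\<Sum>k<length xs. 1 / real (length xs))"
    unfolding matching_plan_def by (intro sum_mono divide_right_mono) auto
  then show "matching_plan xs ys u v \<le> 1"
    using len(2) by simp
next
  fix u
  have ys: "(\<Sum>v\<in>V. of_bool (v = ys ! k)) = (1 :: real)" if "k < length xs" for k
    using that assms(1,3) len by (auto simp: of_bool_def)
  have "(\<Sum>v\<in>V. matching_plan xs ys u v)
      = (\<Sum>k<length xs. \<Sum>v\<in>V. of_bool (u = xs ! k) * of_bool (v = ys ! k) / real (length xs))"
    unfolding matching_plan_def by (rule sum.swap)
  also have "\<dots> = (\<Sum>k<length xs. of_bool (u = xs ! k) / real (length xs))"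
    by (simp add: ys flip: sum_distrib_left sum_divide_distrib)
  finally show "(\<Sum>v\<in>V. matching_plan xs ys u v) = of_bool (u \<in> set xs) / real (length xs)"
    using sum_indicator_nth[OF assms(4), of u] by (simp flip: sum_divide_distrib)
next
  fix v
  have xs: "(\<Sum>u\<in>V. of_bool (u = xs ! k)) = (1 :: real)" if "k < length xs" for k
    using that assms(1,2) by (auto simp: of_bool_def)
  have "(\<Sum>u\<in>V. matching_plan xs ys u v)
      = (\<Sum>k<length xs. \<Sum>u\<in>V. of_bool (u = xs ! k) * of_bool (v = ys ! k) / real (length xs))"
    unfolding matching_plan_def by (rule sum.swap)
  also have "\<dots> = (\<Sum>k<length xs. of_bool (v = ys ! k) / real (length xs))"
    by (simp add: xs flip: sum_distrib_right sum_divide_distrib)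
  finally show "(\<Sum>u\<in>V. matching_plan xs ys u v) = of_bool (v \<in> set ys) / real (length xs)"
    using sum_indicator_nth[OF assms(5), of v] len(1) by (simp flip: sum_divide_distrib)
qed

lemma transport_cost_matching_plan:
  assumes "finite V" "set xs \<subseteq> V" "set ys \<subseteq> V" and len: "length xs = length ys"
  shows "transport_cost V E (matching_plan xs ys)
       = (\<Sum>k<length xs. real (graph_dist E (xs ! k) (ys ! k))) / real (length xs)"
proof -
  let ?d = "\<lambda>u v. real (graph_dist E u v)" and ?m = "real (length xs)"
  have pair: "(\<Sum>u\<in>V. \<Sum>v\<in>V. ?d u v * (of_bool (u = xs ! k) * of_bool (v = ys ! k) / ?m))
      = ?d (xs ! k) (ys ! k) / ?m" if "k < length xs" for k
  proof -
    have V: "xs ! k \<in> V" "ys ! k \<in> V"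
      using that assms by auto
    \<comment> \<open>Nested conditionals let both sums collapse to the single matched pair.\<close>
    have "(\<Sum>u\<in>V. \<Sum>v\<in>V. ?d u v * (of_bool (u = xs ! k) * of_bool (v = ys ! k) / ?m))
        = (\<Sum>u\<in>V. \<Sum>v\<in>V. if v = ys ! k then (if u = xs ! k then ?d u v / ?m else 0) else 0)"
      by (intro sum.cong) auto
    also have "\<dots> = ?d (xs ! k) (ys ! k) / ?m"
      using assms(1) V by simp
    finally show ?thesis .
  qed
  have "transport_cost V E (matching_plan xs ys)
      = (\<Sum>u\<in>V. \<Sum>k<length xs. \<Sum>v\<in>V.
           ?d u v * (of_bool (u = xs ! k) * of_bool (v = ys ! k) / ?m))"
    unfolding transport_cost_def matching_plan_def sum_distrib_left
    by (intro sum.cong refl sum.swap)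
  also have "\<dots> = (\<Sum>k<length xs. \<Sum>u\<in>V. \<Sum>v\<in>V.
           ?d u v * (of_bool (u = xs ! k) * of_bool (v = ys ! k) / ?m))"
    by (rule sum.swap)
  also have "\<dots> = (\<Sum>k<length xs. ?d (xs ! k) (ys ! k) / ?m)"
    by (intro sum.cong refl pair) simp
  finally show ?thesis
    by (simp add: sum_divide_distrib)
qed

section \<open>Curvature from a finite certificate\<close>

lemma lazy_measure_0:
  assumes "E `` {x} = set xs" "distinct xs" "x \<notin> set xs"
  shows "lazy_measure E 0 x = (\<lambda>z. of_bool (z \<in> set xs) / real (length xs))"
proof -
  have "degree E x = length xs"
    unfolding degree_def assms(1) using assms(2) by (rule distinct_card)
  then show ?thesis
    unfolding lazy_measure_def assms(1) using assms(3) by (auto simp: fun_eq_iff)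
qed

text \<open>The walk lengths \<open>ds\<close> bound the cost of the matching from above, the
  potential built from \<open>P\<close> and \<open>M\<close> bounds every cost from below, and
  \<open>dual\<close> makes the two agree. It is an integer equation over lists, so that it can be
  evaluated on explicit data.\<close>

lemma curvature_0_eqI:
  fixes V :: "'a set"
  assumes V: "finite V" "E \<subseteq> V \<times> V" "\<And>u v. u \<in> V \<Longrightarrow> v \<in> V \<Longrightarrow> (u, v) \<in> E\<^sup>*"
    and irrefl: "\<And>z. (z, z) \<notin> E"
    and xs: "E `` {x} = set xs" "distinct xs" "xs \<noteq> []"
    and ys: "E `` {y} = set ys" "distinct ys" "length ys = length xs"
    and match: "list_all2 (\<lambda>d (u, v). (u, v) \<in> E ^^ d) ds (zip xs ys)"
    and PM: "P \<inter> M = {}" "\<And>u v. u \<in> M \<Longrightarrow> v \<in> P \<Longrightarrow> (u, v) \<notin> E"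
    and dual: "int (sum_list ds) =
      (\<Sum>v\<leftarrow>ys. of_bool (v \<in> P) - of_bool (v \<in> M)) - (\<Sum>u\<leftarrow>xs. of_bool (u \<in> P) - of_bool (u \<in> M))"
  shows "curvature V E 0 x y = 1 - real (sum_list ds) / real (length xs)"
proof -
  define f :: "'a \<Rightarrow> real" where "f v = of_bool (v \<in> P) - of_bool (v \<in> M)" for v
  let ?m = "real (length xs)"
  have sub: "set xs \<subseteq> V" "set ys \<subseteq> V"
    using V(2) xs(1) ys(1) by blast+
  have nin: "x \<notin> set xs" "y \<notin> set ys"
    using irrefl xs(1) ys(1) by blast+
  \<comment> \<open>The values of \<open>f\<close> are -1, 0 and 1, so only an edge from
    \<open>M\<close> to \<open>P\<close> could violate the bound.\<close>
  have lip: "f v - f u \<le> 1" if "(u, v) \<in> E" for u v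
    using that PM unfolding f_def by (auto simp: of_bool_def)
  have mean: "(\<Sum>v\<in>V. f v * (of_bool (v \<in> set zs) / ?m)) = (\<Sum>v\<leftarrow>zs. f v) / ?m"
    if "set zs \<subseteq> V" "distinct zs" for zs
  proof -
    have "(\<Sum>v\<in>V. f v * (of_bool (v \<in> set zs) / ?m)) = (\<Sum>v\<in>V. if v \<in> set zs then f v / ?m else 0)"
      by (intro sum.cong) auto
    also have "\<dots> = (\<Sum>v\<in>set zs. f v / ?m)"
      using V(1) that(1) by (simp add: sum.inter_restrict[symmetric] Int_absorb1)
    finally show ?thesis
      using that(2) by (simp add: sum_list_distinct_conv_sum_set sum_divide_distrib)
  qed
  have len: "length ds = length xs"
    using match ys(3) by (auto dest: list_all2_lengthD)
  have "graph_dist E (xs ! k) (ys ! k) \<le> ds ! k" if "k < length xs" for k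
    using that list_all2_nthD2[OF match, of k] ys(3) by (auto intro: graph_dist_le)
  then have "(\<Sum>k<length xs. graph_dist E (xs ! k) (ys ! k)) \<le> (\<Sum>k<length xs. ds ! k)"
    by (intro sum_mono) simp
  also have "\<dots> = sum_list ds"
    using len by (simp add: sum_list_sum_nth atLeast0LessThan)
  finally have "(\<Sum>k<length xs. real (graph_dist E (xs ! k) (ys ! k))) \<le> real (sum_list ds)"
    by (simp only: of_nat_sum[symmetric] of_nat_le_iff)
  then have cost: "transport_cost V E (matching_plan xs ys) \<le> real (sum_list ds) / ?m"
    using V(1) sub ys(3) by (simp add: transport_cost_matching_plan divide_right_mono)
  have f_int: "(\<Sum>v\<leftarrow>zs. f v) = real_of_int (\<Sum>v\<leftarrow>zs. of_bool (v \<in> P) - of_bool (v \<in> M))" for zs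
    by (induction zs) (auto simp: f_def)
  have "real (sum_list ds) = (\<Sum>v\<leftarrow>ys. f v) - (\<Sum>u\<leftarrow>xs. f u)"
    using arg_cong[OF dual, of real_of_int] unfolding f_int by simp
  then have "real (sum_list ds) / ?m \<le> (\<Sum>v\<leftarrow>ys. f v) / ?m - (\<Sum>u\<leftarrow>xs. f u) / ?m"
    by (simp add: diff_divide_distrib)
  then have "W1 V E (\<lambda>u. of_bool (u \<in> set xs) / ?m) (\<lambda>v. of_bool (v \<in> set ys) / ?m)
      = real (sum_list ds) / ?m"
    using V sub xs ys cost mean lip
    by (intro W1_eqI[where \<pi> = "matching_plan xs ys" and f = f] coupling_matching_plan
        lipschitz_graph_dist) auto
  then show ?thesis
    unfolding curvature_def
    using lazy_measure_0[OF xs(1,2) nin(1)] lazy_measure_0[OF ys(1,2) nin(2)] ys(3) by simp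
qed

section \<open>Coordinates around a vertex\<close>

text \<open>\<open>s\<close> selects the Petersen copy and \<open>t\<close>, relevant only modulo 5,
  the place inside it: the \<open>pa\<close> vertices form the outer pentagon (steps of 1), the
  \<open>pb\<close> vertices the inner pentagram (steps of 2).\<close>

definition pa :: "int \<Rightarrow> int \<Rightarrow> int \<Rightarrow> int \<Rightarrow> vertex" where
  "pa q i s t = va q (i + s + t * q)"

definition pb :: "int \<Rightarrow> int \<Rightarrow> int \<Rightarrow> int \<Rightarrow> vertex" where
  "pb q i s t = vb q (i + s + t * q)"

text \<open>The offsets \<open>s\<close> needed below lie between -2 and 2, so for
  \<open>q \<ge> 5\<close> they always differ by less than \<open>q\<close>.\<close>

lemma shift_mod_eq_iff:
  fixes q :: int
  assumes "\<bar>s - s'\<bar> < q"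
  shows "(i + s + t * q) mod (5 * q) = (i + s' + t' * q) mod (5 * q)
    \<longleftrightarrow> s = s' \<and> t mod 5 = t' mod 5"
proof -
  have diff: "(i + s + t * q) - (i + s' + t' * q) = (s - s') + (t - t') * q"
    by (simp add: algebra_simps)
  have "5 * q dvd (s - s') + (t - t') * q \<longleftrightarrow> s = s' \<and> 5 dvd t - t'"
  proof
    assume *: "5 * q dvd (s - s') + (t - t') * q"
    \<comment> \<open>Modulo \<open>q\<close> the term in \<open>t\<close> vanishes, which isolates
      \<open>s - s'\<close>.\<close>
    then have "q dvd (s - s') + (t - t') * q"
      using dvd_mult_right by blast
    then have "q dvd s - s'"
      by (simp add: dvd_add_left_iff)
    then have "s = s'"
      using assms dvd_imp_le_int[of "s - s'" q] by force
    \<comment> \<open>The assumption forces \<open>q > 0\<close>, so the factor \<open>q\<close>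
      cancels.\<close>
    with * assms show "s = s' \<and> 5 dvd t - t'" by simp
  qed auto
  then show ?thesis
    by (simp only: mod_eq_dvd_iff diff)
qed

lemma pa_pb_neq [simp]: "pa q i s t \<noteq> pb q i s' t'" "pb q i s t \<noteq> pa q i s' t'"
  by (simp_all add: pa_def pb_def vertex_eqs)

lemma pa_eq_iff: "\<bar>s - s'\<bar> < q \<Longrightarrow> pa q i s t = pa q i s' t' \<longleftrightarrow> s = s' \<and> t mod 5 = t' mod 5"
  by (simp add: pa_def vertex_eqs shift_mod_eq_iff)

lemma pb_eq_iff: "\<bar>s - s'\<bar> < q \<Longrightarrow> pb q i s t = pb q i s' t' \<longleftrightarrow> s = s' \<and> t mod 5 = t' mod 5"
  by (simp add: pb_def vertex_eqs shift_mod_eq_iff)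

lemma neighbours_pa:
  "H_adj q `` {pa q i s t} =
     set [pa q i (s + 1) t, pa q i (s - 1) t, pa q i s (t + 1), pa q i s (t - 1), pb q i s t]"
  unfolding pa_def pb_def H_neighbours_a by (simp add: algebra_simps)

lemma neighbours_pb:
  "H_adj q `` {pb q i s t} =
     set [pb q i (s + 1) t, pb q i (s - 1) t, pb q i s (t + 2), pb q i s (t - 2), pa q i s t]"
  unfolding pa_def pb_def H_neighbours_b by (simp add: algebra_simps)

lemma adj_pa_iff:
  "(pa q i s t, y) \<in> H_adj q \<longleftrightarrow>
     y \<in> {pa q i (s + 1) t, pa q i (s - 1) t, pa q i s (t + 1), pa q i s (t - 1), pb q i s t}"
  using neighbours_pa[of q i s t] by auto

lemma adj_pb_iff:
  "(pb q i s t, y) \<in> H_adj q \<longleftrightarrow>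
     y \<in> {pb q i (s + 1) t, pb q i (s - 1) t, pb q i s (t + 2), pb q i s (t - 2), pa q i s t}"
  using neighbours_pb[of q i s t] by auto

text \<open>With explicit neighbour sets, finding the midpoint becomes a finite search.\<close>

lemma relpow_two: "(u, v) \<in> E ^^ 2 \<longleftrightarrow> (\<exists>w\<in>E `` {u}. (w, v) \<in> E)"
  by (auto simp: numeral_2_eq_2)

lemma H_curvature_0_eqI:
  assumes "q \<ge> 5"
    and "H_adj q `` {x} = set xs" "distinct xs" "xs \<noteq> []"
    and "H_adj q `` {y} = set ys" "distinct ys" "length ys = length xs"
    and "list_all2 (\<lambda>d (u, v). (u, v) \<in> H_adj q ^^ d) ds (zip xs ys)"
    and "P \<inter> M = {}" "\<forall>u\<in>M. \<forall>v\<in>P. (u, v) \<notin> H_adj q"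
    and "int (sum_list ds) =
      (\<Sum>v\<leftarrow>ys. of_bool (v \<in> P) - of_bool (v \<in> M)) - (\<Sum>u\<leftarrow>xs. of_bool (u \<in> P) - of_bool (u \<in> M))"
  shows "curvature (H_verts q) (H_adj q) 0 x y = 1 - real (sum_list ds) / real (length xs)"
  using assms(2-11)
  by (intro curvature_0_eqI[OF H_finite[OF assms(1)] H_adj_subset H_connected H_adj_irrefl[OF assms(1)]])
    auto

text \<open>\<open>insert_commute\<close> allows neighbour lists to be reordered so that matched
  vertices share a position.\<close>

lemmas coordinate_simps =
  pa_eq_iff pb_eq_iff adj_pa_iff adj_pb_iff neighbours_pa neighbours_pb relpow_two insert_commute

section \<open>The five types of edges\<close>

lemma curvature_a_1:
  assumes "q \<ge> 5"
  shows "curvature (H_verts q) (H_adj q) 0 (pa q i 0 0) (pa q i 1 0) = 0"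
proof -
  let ?xs = "[pa q i 1 0, pa q i (-1) 0, pa q i 0 1, pa q i 0 (-1), pb q i 0 0]"
  let ?ys = "[pa q i 2 0, pa q i 0 0, pa q i 1 1, pa q i 1 (-1), pb q i 1 0]"
  \<comment> \<open>All pairs are translates by 1 in \<open>s\<close>; the potential is the
    indicator of the neighbourhood of the second endpoint.\<close>
  let ?P = "set ?ys" and ?M = "{}"
  have "curvature (H_verts q) (H_adj q) 0 (pa q i 0 0) (pa q i 1 0)
      = 1 - real (sum_list [1, 1, 1, 1, 1 :: nat]) / real (length ?xs)"
    by (rule H_curvature_0_eqI[where P = ?P and M = ?M and ys = ?ys])
      (use assms in \<open>simp_all add: coordinate_simps\<close>)
  then show ?thesis by simp
qed

text \<open>Exchanging \<open>pa\<close> with \<open>pb\<close> and doubling \<open>t\<close> turns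
  steps of 1 into steps of 2 and, modulo 5, steps of 2 into steps of 1; it carries over the data of
  \<open>curvature_a_1\<close>.\<close>

lemma curvature_b_1:
  assumes "q \<ge> 5"
  shows "curvature (H_verts q) (H_adj q) 0 (pb q i 0 0) (pb q i 1 0) = 0"
proof -
  let ?xs = "[pb q i 1 0, pb q i (-1) 0, pb q i 0 2, pb q i 0 (-2), pa q i 0 0]"
  let ?ys = "[pb q i 2 0, pb q i 0 0, pb q i 1 2, pb q i 1 (-2), pa q i 1 0]"
  let ?P = "set ?ys" and ?M = "{}"
  have "curvature (H_verts q) (H_adj q) 0 (pb q i 0 0) (pb q i 1 0)
      = 1 - real (sum_list [1, 1, 1, 1, 1 :: nat]) / real (length ?xs)"
    by (rule H_curvature_0_eqI[where P = ?P and M = ?M and ys = ?ys])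
      (use assms in \<open>simp_all add: coordinate_simps\<close>)
  then show ?thesis by simp
qed

lemma curvature_a_q:
  assumes "q \<ge> 5"
  shows "curvature (H_verts q) (H_adj q) 0 (pa q i 0 0) (pa q i 0 1) = - 1 / 5"
proof -
  let ?xs = "[pa q i 1 0, pa q i (-1) 0, pa q i 0 1, pa q i 0 (-1), pb q i 0 0]"
  let ?ys = "[pa q i 1 1, pa q i (-1) 1, pa q i 0 2, pa q i 0 0, pb q i 0 1]"
  let ?P = "{pa q i 0 2, pb q i 0 1, pa q i 1 1, pa q i (-1) 1}" and ?M = "{pa q i 0 (-1), pb q i 0 0}"
  have "curvature (H_verts q) (H_adj q) 0 (pa q i 0 0) (pa q i 0 1)
      = 1 - real (sum_list [1, 1, 1, 1, 2 :: nat]) / real (length ?xs)"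
    by (rule H_curvature_0_eqI[where P = ?P and M = ?M and ys = ?ys])
      (use assms in \<open>simp_all add: coordinate_simps\<close>)
  then show ?thesis by simp
qed

lemma curvature_b_2q:
  assumes "q \<ge> 5"
  shows "curvature (H_verts q) (H_adj q) 0 (pb q i 0 0) (pb q i 0 2) = - 1 / 5"
proof -
  let ?xs = "[pb q i 1 0, pb q i (-1) 0, pb q i 0 2, pb q i 0 (-2), pa q i 0 0]"
  let ?ys = "[pb q i 1 2, pb q i (-1) 2, pb q i 0 4, pb q i 0 0, pa q i 0 2]"
  \<comment> \<open>Image of the sets in \<open>curvature_a_q\<close> under the same exchange; the
    last pair now has midpoint \<open>pa q i 0 1\<close>.\<close>
  let ?P = "{pb q i 0 4, pa q i 0 2, pb q i 1 2, pb q i (-1) 2}" and ?M = "{pb q i 0 (-2), pa q i 0 0}"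
  have "curvature (H_verts q) (H_adj q) 0 (pb q i 0 0) (pb q i 0 2)
      = 1 - real (sum_list [1, 1, 1, 1, 2 :: nat]) / real (length ?xs)"
    by (rule H_curvature_0_eqI[where P = ?P and M = ?M and ys = ?ys])
      (use assms in \<open>simp_all add: coordinate_simps\<close>)
  then show ?thesis by simp
qed

lemma curvature_a_b:
  assumes "q \<ge> 5"
  shows "curvature (H_verts q) (H_adj q) 0 (pa q i 0 0) (pb q i 0 0) = - 1 / 5"
proof -
  \<comment> \<open>Each endpoint lies in the other's neighbourhood and is matched along a pentagon
    or pentagram edge; the last pair is joined through \<open>pa q i 0 (-2)\<close>.\<close>
  let ?xs = "[pa q i 1 0, pa q i (-1) 0, pa q i 0 1, pb q i 0 0, pa q i 0 (-1)]"
  let ?ys = "[pb q i 1 0, pb q i (-1) 0, pa q i 0 0, pb q i 0 2, pb q i 0 (-2)]"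
  let ?P = "{pb q i 1 0, pb q i (-1) 0, pb q i 0 2, pb q i 0 (-2)}" and ?M = "{pa q i 0 1, pa q i 0 (-1)}"
  have "curvature (H_verts q) (H_adj q) 0 (pa q i 0 0) (pb q i 0 0)
      = 1 - real (sum_list [1, 1, 1, 1, 2 :: nat]) / real (length ?xs)"
    by (rule H_curvature_0_eqI[where P = ?P and M = ?M and ys = ?ys])
      (use assms in \<open>simp_all add: coordinate_simps\<close>)
  then show ?thesis by simp
qed

theorem theorem4p2:
  fixes q :: int
  assumes "q \<ge> 5"
  shows "(\<forall>i::int.
            curvature (H_verts q) (H_adj q) 0 (va q i) (va q (i + 1)) = 0 \<and>
            curvature (H_verts q) (H_adj q) 0 (vb q i) (vb q (i + 1)) = 0 \<and>
            curvature (H_verts q) (H_adj q) 0 (va q i) (va q (i + q)) = - 1 / 5 \<and>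
            curvature (H_verts q) (H_adj q) 0 (vb q i) (vb q (i + 2 * q)) = - 1 / 5 \<and>
            curvature (H_verts q) (H_adj q) 0 (va q i) (vb q i) = - 1 / 5)
         \<and> \<not> bone_idle (H_verts q) (H_adj q)"
proof -
  have edges: "curvature (H_verts q) (H_adj q) 0 (va q i) (va q (i + 1)) = 0 \<and>
      curvature (H_verts q) (H_adj q) 0 (vb q i) (vb q (i + 1)) = 0 \<and>
      curvature (H_verts q) (H_adj q) 0 (va q i) (va q (i + q)) = - 1 / 5 \<and>
      curvature (H_verts q) (H_adj q) 0 (vb q i) (vb q (i + 2 * q)) = - 1 / 5 \<and>
      curvature (H_verts q) (H_adj q) 0 (va q i) (vb q i) = - 1 / 5" for i
    using curvature_a_1[OF assms, of i] curvature_b_1[OF assms, of i]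
      curvature_a_q[OF assms, of i] curvature_b_2q[OF assms, of i] curvature_a_b[OF assms, of i]
    by (simp add: pa_def pb_def)
  have "\<not> bone_idle (H_verts q) (H_adj q)"
  proof
    assume "bone_idle (H_verts q) (H_adj q)"
    \<comment> \<open>Idleness 0 on a single edge between an \<open>A\<close> and a \<open>B\<close>
      vertex already gives the contradiction.\<close>
    then have "bone_idle_edge (H_verts q) (H_adj q) (va q 0) (vb q 0)"
      using H_adj_intros(5)[of q 0] by (auto simp: bone_idle_def)
    then have "curvature (H_verts q) (H_adj q) 0 (va q 0) (vb q 0) = 0"
      by (simp add: bone_idle_edge_def)
    then show False
      using edges[of 0] by simp
  qed
  with edges show ?thesis by blast
qed

end
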